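(* Let $p$ be an odd prime, $n$ a positive integer and $q=p^{2n}$. Let $s\ge 1$, let $a_1,\dots,a_s\in\mathbb{F}_q$, and let $t_1,\dots,t_s$ be positive integers with $t_i\mid n$ for all $i$. Let $d_1,\dots,d_s$ be positive integers and assume that for each $i=1,\dots,s$ there exists a divisor $r_i$ of $t_i$ such that $d_i\mid (p^{r_i}+1)$. Let $N$ be the number of tuples $(x_1,\dots,x_s)$ with $x_i\in\mathbb{F}_{p^{2t_i}}$ for all $i$ satisfying $$a_1x_1^{d_1}+\cdots+a_sx_s^{d_s}=0.$$ Then $$N=p^{t_1+\cdots+t_s-2n}\sum_{c\in\mathbb{F}_q}\prod_{i=1}^{s}\Delta(a_i,d_i,t_i,r_i,c).$$
   Context: For $m\mid n$, $\operatorname{tr}_{p^{2n},p^{2m}}$ denotes the trace map from $\mathbb{F}_{p^{2n}}$ to $\mathbb{F}_{p^{2m}}$. For $a\in\mathbb{F}_q$ and positive integers $d,t,r$ with $r\mid t$, $t\mid n$ and $d\mid (p^r+1)$, set $m=\frac{p^{2t}-1}{d}$, $u=\frac{p^r+1}{d}$, $\varepsilon=(-1)^{t/r}$ and $T(x)=\operatorname{tr}_{q,p^{2t}}(x)$, and for $c\in\mathbb{F}_q$ define $$\Delta(a,d,t,r,c)=\begin{cases}p^{t},&\text{if }T(ca)=0;\\ \varepsilon(1-d),&\text{if }T(ca)^{m}=\varepsilon^{u};\\ \varepsilon,&\text{if }T(ca)^m\notin\{0,\varepsilon^u\}.\end{cases}$$ *)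

theory Defs
  imports Complex_Main "HOL-Computational_Algebra.Primes" "HOL-Library.Cardinality"
begin

text \<open>The ambient field F_q, q = p^(2n), is modelled as a finite field type 'a with
  CARD('a) = p^(2n). The subfield F_(p^k) is the set of fixed points of x \<mapsto> x^(p^k).\<close>

definition subfld :: "nat \<Rightarrow> nat \<Rightarrow> ('a::field) set" where
  "subfld p k = {x. x ^ (p ^ k) = x}"

definition trace :: "nat \<Rightarrow> nat \<Rightarrow> nat \<Rightarrow> 'a::field \<Rightarrow> 'a" where
  "trace p n t x = (\<Sum>j<n div t. x ^ (p ^ (2 * t * j)))"

definition Delta :: "nat \<Rightarrow> nat \<Rightarrow> 'a::field \<Rightarrow> nat \<Rightarrow> nat \<Rightarrow> nat \<Rightarrow> 'a \<Rightarrow> int" where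
  "Delta p n a d t r c =
    (let m = (p ^ (2 * t) - 1) div d;
         u = (p ^ r + 1) div d;
         eps = (-1::int) ^ (t div r);
         T = trace p n t (c * a)
     in if T = 0 then int p ^ t
        else if T ^ m = of_int (eps ^ u) then eps * (1 - int d)
        else eps)"

end

theory Submission
  imports Defs "HOL-Computational_Algebra.Polynomial" "HOL-Number_Theory.Cong"
    "HOL-Library.Real_Mod" "HOL-Library.FuncSet"
begin

text \<open>
  Orthogonality of an additive character \<open>\<psi>\<close> of the ambient field gives
  \<open>q N = (\<Sum>c. \<Prod>i. \<Sum>x\<in>K\<^sub>i. \<psi> (c a\<^sub>i x ^ d\<^sub>i))\<close>, and transitivity of the trace turns the inner
  sums into Weil sums \<open>S\<^sub>d b = (\<Sum>x\<in>K. \<chi> (b x ^ d))\<close> over \<open>K\<close> of order \<open>Q = p ^ (2 t)\<close>,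
  with \<open>b\<close> the trace of \<open>c a\<^sub>i\<close>.

  Write \<open>P = p ^ r\<close> and \<open>t = r e\<close>. For \<open>d = P + 1\<close> the exponent is a quadratic form, so
  \<open>\<bar>S b\<bar>\<^sup>2\<close> is \<open>Q\<close> times the size of its radical, which is \<open>P\<^sup>2\<close> or \<open>1\<close>. Averaging over
  the subfield of order \<open>P\<close>, all of whose nonzero elements are \<open>(P + 1)\<close>-th powers in \<open>K\<close>,
  shows that \<open>S b\<close> is an integer congruent to \<open>1\<close> modulo \<open>P + 1\<close>. As
  \<open>P \<equiv> -1\<close>, this fixes the sign. A general divisor \<open>d\<close> of \<open>P + 1\<close> is reached by averaging
  \<open>S (b y ^ d)\<close> over the nonzero \<open>y\<close>.
\<close>

subsection \<open>Roots of unity in finite fields\<close>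

text \<open>Multiplication by \<open>x\<close> permutes the nonzero elements, so their product
  absorbs the factor \<open>x ^ (CARD('a) - 1)\<close>.\<close>

lemma finite_field_power_card_minus_1:
  fixes x :: "'a::{field,finite}"
  assumes "x \<noteq> 0"
  shows "x ^ (CARD('a) - 1) = 1"
proof -
  have "(\<Prod>y\<in>UNIV-{0}. x * y) = (\<Prod>y\<in>UNIV-{0}. y)"
    by (rule prod.reindex_bij_witness[of _ "\<lambda>y. y / x" "\<lambda>y. x * y"]) (use assms in auto)
  then have "x ^ (CARD('a) - 1) * \<Prod>(UNIV-{0}) = 1 * \<Prod>(UNIV-{0})"
    by (simp add: prod.distrib)
  then show ?thesis
    by (subst (asm) mult_right_cancel) auto
qed

lemma card_power_eq_le:
  fixes w :: "'a::idom"
  assumes "k > 0"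
  shows "card {x. x ^ k = w} \<le> k"
proof -
  let ?f = "monom 1 k + [:- w:]"
  have deg: "degree ?f = k"
    using assms degree_add_eq_left[of "[:- w:]" "monom 1 k"] by (simp add: degree_monom_eq)
  then have "?f \<noteq> 0"
    using assms by force
  from card_poly_roots_bound[OF this] deg show ?thesis
    by (simp add: poly_monom)
qed

text \<open>The \<open>k l\<close> roots of unity are mapped by \<open>x \<mapsto> x ^ k\<close> to at most \<open>l\<close> values, and each
  fibre has at most \<open>k\<close> elements, so every fibre has exactly \<open>k\<close>.\<close>
lemma card_power_eq_aux:
  fixes w :: "'a::{field,finite}"
  assumes "card {x::'a. x ^ (k * l) = 1} = k * l" "k * l > 0" "w ^ l = 1"
  shows "card {x. x ^ k = w} = k"
proof -
  let ?G = "{x::'a. x ^ (k * l) = 1}" and ?H = "{v::'a. v ^ l = 1}"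
  let ?c = "\<lambda>v::'a. card {x. x ^ k = v}"
  have le: "?c v \<le> k" for v
    using assms by (intro card_power_eq_le) auto
  have leH: "card ?H \<le> l"
    using assms by (intro card_power_eq_le) auto
  have "(\<Sum>v\<in>?H. \<Sum>x\<in>{x\<in>?G. x ^ k = v}. 1) = (\<Sum>x\<in>?G. 1::nat)"
    by (intro sum.group) (auto simp: power_mult)
  moreover have "{x. x ^ k = v} = {x\<in>?G. x ^ k = v}" if "v \<in> ?H" for v
    using that by (auto simp: power_mult)
  then have "(\<Sum>v\<in>?H. ?c v) = (\<Sum>v\<in>?H. card {x\<in>?G. x ^ k = v})"
    by (rule sum.cong[OF refl arg_cong[where f = card]])
  ultimately have "(\<Sum>v\<in>?H. ?c v) = card ?G"
    by simp
  with assms(1) have eq: "(\<Sum>v\<in>?H. ?c v) = k * l"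
    by simp
  have "(\<Sum>v\<in>?H. ?c v) = (\<Sum>v\<in>?H. k)"
  proof (rule antisym)
    show "(\<Sum>v\<in>?H. ?c v) \<le> (\<Sum>v\<in>?H. k)"
      by (intro sum_mono le)
    show "(\<Sum>v\<in>?H. k) \<le> (\<Sum>v\<in>?H. ?c v)"
      unfolding eq using leH by (simp add: mult.commute)
  qed
  from sum_mono_inv[OF this le, of w] assms(3) show ?thesis
    by simp
qed

text \<open>Two descents through \<open>card_power_eq_aux\<close>: from the whole multiplicative
  group to the \<open>k * l\<close>-th roots of unity, then to the \<open>k\<close>-th roots of
  \<open>w\<close>. It supplies existence of roots as well as their number.\<close>

lemma card_power_eq:
  fixes w :: "'a::{field,finite}"
  assumes "(k * l) dvd (CARD('a) - 1)" "w ^ l = 1"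
  shows "card {x. x ^ k = w} = k"
proof -
  have gt: "CARD('a) > 1"
    using card_mono[of UNIV "{0, 1::'a}"] by simp
  obtain j where j: "CARD('a) - 1 = (k * l) * j"
    using assms by (auto elim: dvdE)
  have "{x::'a. x ^ (CARD('a) - 1) = 1} = UNIV - {0}"
    using gt finite_field_power_card_minus_1 by (auto simp: power_0_left)
  then have "card {x::'a. x ^ (CARD('a) - 1) = 1} = CARD('a) - 1"
    by simp
  then have 1: "card {x::'a. x ^ (k * l * j) = 1} = k * l * j"
    by (simp only: j)
  have pos: "k * l * j > 0"
    using gt by (simp only: j[symmetric])
  have 2: "card {x::'a. x ^ (k * l) = 1} = k * l"
    by (rule card_power_eq_aux[OF 1 pos]) simp
  show ?thesis
    by (rule card_power_eq_aux[OF 2 _ assms(2)]) (use pos in simp)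
qed

lemma power_minus_1_dvd:
  assumes "k dvd n"
  shows "(p ^ k - 1) dvd (p ^ n - 1 :: nat)"
proof (cases "p = 0")
  case False
  then have pos: "p ^ i \<ge> 1" for i
    by simp
  obtain j where "n = k * j"
    using assms by (auto elim: dvdE)
  moreover have "[p ^ k = 1] (mod (p ^ k - 1))"
    using pos[of k] by (simp add: cong_altdef_nat)
  then have "[(p ^ k) ^ j = 1 ^ j] (mod (p ^ k - 1))"
    by (rule cong_pow)
  ultimately show ?thesis
    using pos[of n] by (simp add: cong_altdef_nat power_mult)
qed (use assms in \<open>auto simp: power_0_left\<close>)

text \<open>Each nonempty fibre of \<open>x ^ m\<close> on \<open>A\<close> is a full coset of the
  \<open>m\<close>-th roots of unity.\<close>

lemma card_dvd_of_root_of_unity_invariant: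
  fixes A :: "'a::{field,finite} set"
  assumes "0 \<notin> A" "m > 0" "card {h::'a. h ^ m = 1} = m"
    and inv: "\<And>h x. h ^ m = 1 \<Longrightarrow> x \<in> A \<Longrightarrow> h * x \<in> A"
  shows "m dvd card A"
proof -
  have "card {x\<in>A. x ^ m = v} = m" if v: "v \<in> (\<lambda>x. x ^ m) ` A" for v
  proof -
    from v obtain y where y: "y \<in> A" "v = y ^ m" "y \<noteq> 0"
      using assms(1) by auto
    have "bij_betw (\<lambda>h. h * y) {h. h ^ m = 1} {x\<in>A. x ^ m = v}"
      by (rule bij_betw_byWitness[where f' = "\<lambda>x. x / y"])
         (use y inv in \<open>auto simp: power_mult_distrib power_divide\<close>)
    from bij_betw_same_card[OF this] assms(3) show ?thesis
      by simp
  qed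
  moreover have "card A = (\<Sum>v\<in>(\<lambda>x. x ^ m) ` A. card {x\<in>A. x ^ m = v})"
    using sum.group[of A "(\<lambda>x. x ^ m) ` A" "\<lambda>x. x ^ m" "\<lambda>_. 1::nat"] by simp
  ultimately show ?thesis
    by simp
qed

text \<open>Truncated subtraction is harmless: at \<open>x = 0\<close> both sides are 0.\<close>

lemma sum_geometric_nat: "((x::nat) - 1) * (\<Sum>i<e. x ^ i) = x ^ e - 1"
proof (cases "x = 0")
  case False
  have "(x - 1) * (\<Sum>i<e. x ^ i) + 1 = x ^ e"
  proof (induction e)
    case (Suc e)
    have "(x - 1) * (\<Sum>i<Suc e. x ^ i) + 1 = ((x - 1) * (\<Sum>i<e. x ^ i) + 1) + (x - 1) * x ^ e"
      by (simp add: distrib_left)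
    also have "\<dots> = (1 + (x - 1)) * x ^ e"
      unfolding Suc by (simp add: distrib_right)
    finally show ?case
      using False by simp
  qed simp
  then show ?thesis
    by linarith
qed (cases e; simp add: power_0_left)

lemma even_sum_powers: "odd (x::nat) \<Longrightarrow> even (\<Sum>i<e. x ^ i) \<longleftrightarrow> even e"
  by (induction e) auto

subsection \<open>Additive characters\<close>

text \<open>If \<open>\<phi> z\<close> differs from 1, translation by \<open>z\<close> permutes
  \<open>L\<close> and multiplies the sum by \<open>\<phi> z\<close>, so the sum vanishes.\<close>

lemma sum_additive_char:
  fixes \<phi> :: "'a::ab_group_add \<Rightarrow> 'b::idom"
  assumes "finite L" and add: "\<And>x y. x \<in> L \<Longrightarrow> y \<in> L \<Longrightarrow> x + y \<in> L"
    and hom: "\<And>x y. x \<in> L \<Longrightarrow> y \<in> L \<Longrightarrow> \<phi> (x + y) = \<phi> x * \<phi> y"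
  shows "(\<Sum>x\<in>L. \<phi> x) = (if \<forall>x\<in>L. \<phi> x = 1 then of_nat (card L) else 0)"
proof (cases "\<forall>x\<in>L. \<phi> x = 1")
  case False
  then obtain z where z: "z \<in> L" "\<phi> z \<noteq> 1"
    by blast
  have "(\<lambda>x. x + z) ` L = L"
    using assms(1) z add by (intro endo_inj_surj) (auto intro: inj_onI)
  then have "bij_betw (\<lambda>x. x + z) L L"
    by (simp add: bij_betw_def inj_on_def)
  from sum.reindex_bij_betw[OF this, of \<phi>] have "(\<Sum>x\<in>L. \<phi> x) = (\<Sum>x\<in>L. \<phi> x) * \<phi> z"
    using z by (simp add: hom sum_distrib_right)
  then have "(\<Sum>x\<in>L. \<phi> x) * (\<phi> z - 1) = 0"
    by (simp add: algebra_simps)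
  with z False show ?thesis
    by auto
qed simp

definition abs_trace :: "nat \<Rightarrow> nat \<Rightarrow> 'a::field \<Rightarrow> 'a" where
  "abs_trace p k y = (\<Sum>j<k. y ^ p ^ j)"

text \<open>Meaningful only on the prime field, where \<open>x\<close> is the image of a natural number;
  \<open>abs_trace p k\<close> takes values there on \<open>subfld p k\<close> only.\<close>
definition prime_char :: "nat \<Rightarrow> 'a::field \<Rightarrow> complex" where
  "prime_char p x = cis (2 * pi * real (LEAST m. of_nat m = x) / real p)"

definition add_char :: "nat \<Rightarrow> nat \<Rightarrow> 'a::field \<Rightarrow> complex" where
  "add_char p k y = prime_char p (abs_trace p k y)"

locale odd_finite_field =
  fixes p N :: nat and ty :: "'a::{field,finite} itself"
  assumes prime_p: "prime p" and odd_p: "odd p" and card_UNIV: "CARD('a) = p ^ N"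
begin

text \<open>The shift by 1 permutes the field, so comparing sums over all elements shows that the
  field size is 0 in the field; the characteristic is thus a prime divisor of
  \<open>p ^ N\<close>.\<close>

lemma CHAR_eq: "CHAR('a) = p"
proof -
  have "(\<Sum>x\<in>UNIV. x + 1) = (\<Sum>x\<in>UNIV. x :: 'a)"
    by (rule sum.reindex_bij_witness[of _ "\<lambda>x. x - 1" "\<lambda>x. x + 1"]) auto
  then have "of_nat CARD('a) = (0::'a)"
    by (simp add: sum.distrib)
  then have "CHAR('a) dvd p ^ N"
    by (simp only: of_nat_eq_0_iff_char_dvd card_UNIV)
  moreover have "prime CHAR('a)"
    by (intro prime_CHAR_semidom finite_imp_CHAR_pos) simp
  ultimately show ?thesis
    using prime_p by (meson prime_dvd_power primes_dvd_imp_eq)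
qed

lemma p_gt_2: "p > 2"
  using prime_p odd_p by (metis even_numeral order_le_imp_less_or_eq prime_ge_2_nat)

section \<open>Frobenius powers and their fixed subfields\<close>

lemma frob_add: "((x::'a) + y) ^ p ^ k = x ^ p ^ k + y ^ p ^ k"
  using prime_p CHAR_eq by (intro freshmans_dream') auto

lemma frob_sum: "(sum f A :: 'a) ^ p ^ k = (\<Sum>i\<in>A. f i ^ p ^ k)"
  using prime_p CHAR_eq by (intro freshmans_dream_sum') auto

lemma frob_minus: "(- x :: 'a) ^ p ^ k = - (x ^ p ^ k)"
  using odd_p by (simp add: power_minus_odd)

lemma subfld_0 [simp]: "(0::'a) \<in> subfld p k"
  using p_gt_2 by (simp add: subfld_def power_0_left)

lemma subfld_add: "(x::'a) \<in> subfld p k \<Longrightarrow> y \<in> subfld p k \<Longrightarrow> x + y \<in> subfld p k"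
  by (simp add: subfld_def frob_add)

lemma subfld_minus: "(x::'a) \<in> subfld p k \<Longrightarrow> - x \<in> subfld p k"
  by (simp add: subfld_def frob_minus)

lemma subfld_mult: "(x::'a) \<in> subfld p k \<Longrightarrow> y \<in> subfld p k \<Longrightarrow> x * y \<in> subfld p k"
  by (simp add: subfld_def power_mult_distrib)

lemma subfld_divide: "(x::'a) \<in> subfld p k \<Longrightarrow> y \<in> subfld p k \<Longrightarrow> x / y \<in> subfld p k"
  by (simp add: subfld_def power_divide)

lemma subfld_power: "(x::'a) \<in> subfld p k \<Longrightarrow> x ^ m \<in> subfld p k"
  by (simp add: subfld_def) (metis power_mult mult.commute)

lemma subfld_diff: "(x::'a) \<in> subfld p k \<Longrightarrow> y \<in> subfld p k \<Longrightarrow> x - y \<in> subfld p k"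
  using subfld_add[of x k "- y"] subfld_minus by simp

lemma subfld_sum: "(\<And>i. i \<in> A \<Longrightarrow> f i \<in> subfld p k) \<Longrightarrow> (sum f A :: 'a) \<in> subfld p k"
  by (induction A rule: infinite_finite_induct) (auto simp: subfld_add)

lemma subfld_mono:
  assumes "k dvd l" "(x::'a) \<in> subfld p k"
  shows "x \<in> subfld p l"
proof -
  obtain j where j: "l = k * j"
    using assms by (auto elim: dvdE)
  have "x ^ p ^ (k * j) = x"
  proof (induction j)
    case (Suc j)
    have "x ^ p ^ (k * Suc j) = (x ^ p ^ k) ^ p ^ (k * j)"
      by (simp add: power_add flip: power_mult)
    with Suc assms show ?case
      by (simp add: subfld_def)
  qed simp
  with j show ?thesis
    by (simp add: subfld_def)
qed

text \<open>Turns subfield membership into a root-of-unity condition, so that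
  \<open>card_power_eq\<close> can count. For \<open>k = 0\<close> the exponent would be 0 and the
  left side would hold at \<open>x = 0\<close>.\<close>

lemma power_frob_subfld:
  assumes "k > 0"
  shows "(x::'a) ^ (p ^ k - 1) = 1 \<longleftrightarrow> x \<in> subfld p k - {0}"
proof -
  have gt: "p ^ k > 1"
    using p_gt_2 assms one_less_power[of p k] by linarith
  then have "p ^ k = Suc (p ^ k - 1)"
    by simp
  then have "x ^ p ^ k = x * x ^ (p ^ k - 1)"
    by (metis power_Suc)
  with gt show ?thesis
    by (auto simp: subfld_def power_0_left)
qed

lemma subfld_nonzero_eq: "k > 0 \<Longrightarrow> subfld p k - {0::'a} = {x. x ^ (p ^ k - 1) = 1}"
  using power_frob_subfld by blast

lemma card_subfld:
  assumes "k > 0" "k dvd N"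
  shows "card (subfld p k :: 'a set) = p ^ k"
proof -
  have "card (subfld p k - {0::'a}) = p ^ k - 1"
    unfolding subfld_nonzero_eq[OF assms(1)]
    by (rule card_power_eq[where l = 1]) (use power_minus_1_dvd[OF assms(2)] card_UNIV in auto)
  moreover have "card (subfld p k :: 'a set) > 0"
    by (subst card_gt_0_iff) (auto intro: exI[of _ 0] subfld_0)
  ultimately show ?thesis
    using p_gt_2 by (simp add: card_Diff_singleton) (metis Suc_pred gr_zeroI not_numeral_less_zero zero_less_power)
qed

lemma N_pos: "N > 0"
proof (rule gr0I)
  assume "N = 0"
  then show False
    using card_UNIV card_mono[of UNIV "{0, 1::'a}"] by simp
qed

lemma subfld_UNIV: "subfld p N = (UNIV :: 'a set)"
  using card_subfld[of N] card_UNIV N_pos by (intro card_subset_eq) auto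

text \<open>The images of the naturals are fixed by Frobenius and include \<open>p\<close> distinct
  values, while there are only \<open>p\<close> fixed points.\<close>

lemma subfld_1_eq: "subfld p 1 = range (of_nat :: nat \<Rightarrow> 'a)"
proof -
  have eq: "of_nat m = (of_nat l :: 'a) \<longleftrightarrow> [m = l] (mod p)" for m l
    using of_nat_eq_iff_cong_CHAR[of m l, where 'a = 'a] CHAR_eq by simp
  have sub: "range (of_nat :: nat \<Rightarrow> 'a) \<subseteq> subfld p 1"
  proof clarify
    fix m show "(of_nat m :: 'a) \<in> subfld p 1"
    proof (induction m)
      case (Suc m)
      moreover have "(1::'a) \<in> subfld p 1"
        by (simp add: subfld_def)
      ultimately show ?case
        by (simp add: subfld_add)
    qed simp
  qed
  have "inj_on (of_nat :: nat \<Rightarrow> 'a) {..<p}"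
    by (auto simp: inj_on_def eq cong_less_modulus_unique_nat)
  then have "card (of_nat ` {..<p} :: 'a set) = p"
    by (simp add: card_image)
  then have "p \<le> card (range (of_nat :: nat \<Rightarrow> 'a))"
    by (metis card_mono finite_code image_mono subset_UNIV)
  with sub show ?thesis
    using card_subfld[of 1] by (intro card_seteq[symmetric]) auto
qed

section \<open>Absolute trace and additive character\<close>

lemma abs_trace_add: "abs_trace p k (x + y :: 'a) = abs_trace p k x + abs_trace p k y"
  by (simp add: abs_trace_def frob_add sum.distrib)

text \<open>Frobenius shifts the summands by one place; the new last one, \<open>x ^ p ^ k\<close>,
  equals the lost first one, \<open>x\<close>.\<close>

lemma abs_trace_frob:
  assumes "(x::'a) \<in> subfld p k"
  shows "abs_trace p k (x ^ p) = abs_trace p k x"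
proof (cases k)
  case (Suc k')
  have "abs_trace p k (x ^ p) = (\<Sum>j<k. x ^ p ^ Suc j)"
    by (simp add: abs_trace_def flip: power_mult)
  also have "\<dots> + x = abs_trace p k x + x ^ p ^ k"
    using sum.lessThan_Suc[of "\<lambda>j. x ^ p ^ j" k] sum.lessThan_Suc_shift[of "\<lambda>j. x ^ p ^ j" k]
    by (simp add: abs_trace_def add.commute del: sum.lessThan_Suc)
  finally show ?thesis
    using assms by (simp add: subfld_def)
qed (simp add: abs_trace_def)

lemma abs_trace_in:
  assumes "(x::'a) \<in> subfld p k"
  shows "abs_trace p k x \<in> subfld p 1"
proof -
  have "abs_trace p k x ^ p = abs_trace p k (x ^ p)"
    using frob_sum[of "\<lambda>j. x ^ p ^ j" "{..<k}" 1]
    by (simp add: abs_trace_def mult.commute flip: power_mult)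
  with abs_trace_frob[OF assms] show ?thesis
    by (simp add: subfld_def)
qed

text \<open>The least representative differs from \<open>m\<close> by a multiple of
  \<open>p\<close>, which changes the angle by a multiple of \<open>2 * pi\<close>.\<close>

lemma prime_char_of_nat: "prime_char p (of_nat m :: 'a) = cis (2 * pi * real m / real p)"
proof -
  define l where "l = (LEAST l. of_nat l = (of_nat m :: 'a))"
  have "of_nat l = (of_nat m :: 'a)"
    unfolding l_def by (rule LeastI) simp
  then have "[l = m] (mod p)"
    using of_nat_eq_iff_cong_CHAR[of l m, where 'a = 'a] CHAR_eq by simp
  then have "[int l = int m] (mod int p)"
    by (simp add: cong_int_iff)
  then obtain i where i: "int m = int l + int p * i"
    by (auto simp: cong_iff_lin)
  have m: "real m = real l + real p * of_int i"
    using arg_cong[OF i, of real_of_int] by simp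
  have "2 * pi * real m / real p = 2 * pi * real l / real p + 2 * pi * of_int i"
    unfolding m using p_gt_2 by (simp add: field_simps)
  then have "cis (2 * pi * real m / real p) = cis (2 * pi * real l / real p)"
    by (simp flip: cis_mult)
  then show ?thesis
    by (simp add: prime_char_def l_def)
qed

lemma prime_char_eq_1_iff: "prime_char p (of_nat m :: 'a) = 1 \<longleftrightarrow> of_nat m = (0::'a)"
proof
  assume "prime_char p (of_nat m :: 'a) = 1"
  then obtain i where "2 * pi * real m / real p = of_int i * (2 * pi)"
    by (auto simp: prime_char_of_nat cis_eq_1_iff)
  then have "real m = of_int i * real p"
    using p_gt_2 by (simp add: field_simps)
  then have "int m = i * int p"
    by (metis of_int_eq_iff of_int_mult of_int_of_nat_eq)
  then have "int p dvd int m"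
    by simp
  then show "of_nat m = (0::'a)"
    using of_nat_eq_0_iff_char_dvd[of m, where 'a = 'a] CHAR_eq by simp
next
  assume "of_nat m = (0::'a)"
  then show "prime_char p (of_nat m :: 'a) = 1"
    using prime_char_of_nat[of 0] by simp
qed

lemma add_char_cases:
  assumes "(x::'a) \<in> subfld p k"
  obtains m where "abs_trace p k x = of_nat m" "add_char p k x = cis (2 * pi * real m / real p)"
proof -
  from abs_trace_in[OF assms] obtain m where "abs_trace p k x = of_nat m"
    unfolding subfld_1_eq by blast
  with that show ?thesis
    by (simp add: add_char_def prime_char_of_nat)
qed

lemma add_char_0 [simp]: "add_char p k (0::'a) = 1"
  using prime_char_of_nat[of 0] p_gt_2 by (simp add: add_char_def abs_trace_def power_0_left)

lemma add_char_add:
  assumes x: "(x::'a) \<in> subfld p k" and y: "y \<in> subfld p k"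
  shows "add_char p k (x + y) = add_char p k x * add_char p k y"
proof -
  from add_char_cases[OF x] obtain m where
    m: "abs_trace p k x = of_nat m" "add_char p k x = cis (2 * pi * real m / real p)" .
  from add_char_cases[OF y] obtain l where
    l: "abs_trace p k y = of_nat l" "add_char p k y = cis (2 * pi * real l / real p)" .
  have "add_char p k (x + y) = prime_char p (of_nat (m + l) :: 'a)"
    by (simp add: add_char_def abs_trace_add m l)
  also have "\<dots> = cis (2 * pi * real m / real p) * cis (2 * pi * real l / real p)"
    by (simp only: prime_char_of_nat cis_mult) (simp add: distrib_left add_divide_distrib)
  finally show ?thesis
    by (simp add: m l)
qed

lemma add_char_sum:
  assumes "\<And>i. i \<in> A \<Longrightarrow> f i \<in> subfld p k"
  shows "add_char p k (sum f A :: 'a) = (\<Prod>i\<in>A. add_char p k (f i))"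
  using assms
  by (induction A rule: infinite_finite_induct) (auto simp: add_char_add subfld_sum)

lemma add_char_frob:
  assumes "(x::'a) \<in> subfld p k"
  shows "add_char p k (x ^ p ^ j) = add_char p k x"
proof (induction j)
  case (Suc j)
  have "x ^ p ^ Suc j = (x ^ p ^ j) ^ p"
    by (simp add: mult.commute flip: power_mult)
  with Suc show ?case
    using abs_trace_frob[OF subfld_power[OF assms]] by (simp add: add_char_def)
qed simp

lemma add_char_power_p:
  assumes "(x::'a) \<in> subfld p k"
  shows "add_char p k x ^ p = 1"
proof -
  from add_char_cases[OF assms] obtain m where "add_char p k x = cis (2 * pi * real m / real p)" .
  then have "add_char p k x ^ p = cis (2 * pi * of_nat m)"
    using p_gt_2 by (simp add: DeMoivre)
  then show ?thesis
    by (simp add: cis_multiple_2pi del: of_nat_mult)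
qed

lemma add_char_minus:
  assumes "(x::'a) \<in> subfld p k"
  shows "add_char p k (- x) = cnj (add_char p k x)"
proof -
  from add_char_cases[OF assms] obtain m where m: "add_char p k x = cis (2 * pi * real m / real p)" .
  have "add_char p k x * add_char p k (- x) = 1"
    using add_char_add[of x k "- x"] assms by (simp add: subfld_minus)
  moreover have "add_char p k x * cnj (add_char p k x) = 1"
    by (simp add: m cis_cnj cis_mult)
  ultimately show ?thesis
    by (metis mult_cancel_left mult_zero_left zero_neq_one)
qed

text \<open>The trace is a nonzero polynomial of degree at most \<open>p ^ (k - 1)\<close>, too
  small to vanish on all \<open>p ^ k\<close> elements of the subfield.\<close>

lemma add_char_nontrivial:
  assumes "k > 0" "k dvd N"
  obtains z where "(z::'a) \<in> subfld p k" "add_char p k z \<noteq> 1"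
proof -
  define f where "f = (\<Sum>j<k. monom (1::'a) (p ^ j))"
  have poly_f: "poly f x = abs_trace p k x" for x
    by (simp add: f_def abs_trace_def poly_sum poly_monom)
  \<comment> \<open>Only \<open>j = 0\<close> gives the exponent 1, so the linear coefficient
    witnesses that \<open>f\<close> is nonzero.\<close>
  have "coeff f 1 = (\<Sum>j<k. if j = 0 then 1 else 0)"
    unfolding f_def coeff_sum using p_gt_2 by (intro sum.cong) auto
  then have f0: "f \<noteq> 0"
    using assms by (auto simp: sum.delta)
  have "degree f \<le> p ^ (k - 1)"
    unfolding f_def using p_gt_2
    by (intro degree_sum_le) (auto intro!: order.trans[OF degree_monom_le] power_increasing)
  also have "\<dots> < p ^ k"
    using p_gt_2 assms by (intro power_strict_increasing) auto
  also have "\<dots> = card (subfld p k :: 'a set)"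
    using card_subfld assms by simp
  finally have "card {x::'a. poly f x = 0} < card (subfld p k :: 'a set)"
    using card_poly_roots_bound[OF f0] by linarith
  then have "\<not> subfld p k \<subseteq> {x::'a. poly f x = 0}"
    using card_mono[of "{x::'a. poly f x = 0}" "subfld p k"] by force
  then obtain z :: 'a where z: "z \<in> subfld p k" "abs_trace p k z \<noteq> 0"
    using poly_f by auto
  from abs_trace_in[OF z(1)] obtain m where "abs_trace p k z = of_nat m"
    unfolding subfld_1_eq by blast
  with z that prime_char_eq_1_iff[of m] show ?thesis
    by (auto simp: add_char_def)
qed

end

subsection \<open>Pure Weil sums\<close>

text \<open>The \<open>t\<close> of the theorem is \<open>r * e\<close>, so that
  \<open>(-1) ^ e\<close> is its sign \<epsilon>.\<close>

locale weil_sum = odd_finite_field p N ty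
  for p N and ty :: "'a::{field,finite} itself" +
  fixes r e :: nat
  assumes r_pos: "r > 0" and e_pos: "e > 0" and dvd_N: "2 * (r * e) dvd N"
begin

abbreviation "P \<equiv> p ^ r"
abbreviation "Q \<equiv> p ^ (2 * (r * e))"
abbreviation "K \<equiv> subfld p (2 * (r * e)) :: 'a set"
abbreviation "\<chi> \<equiv> add_char p (2 * (r * e)) :: 'a \<Rightarrow> complex"
text \<open>This is the quotient of \<open>Q - 1\<close> by \<open>P ^ 2 - 1\<close>; it has the
  same parity as \<open>e\<close>.\<close>

abbreviation "l \<equiv> \<Sum>i<e. (P ^ 2) ^ i"

definition weil :: "nat \<Rightarrow> 'a \<Rightarrow> complex" where
  "weil d b = (\<Sum>x\<in>K. \<chi> (b * x ^ d))"

lemma P_gt_2: "P > 2"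
  using p_gt_2 self_le_power[of p r] r_pos by linarith

lemma odd_P: "odd P"
  using odd_p by simp

lemma Q_eq: "Q = (P ^ 2) ^ e"
  by (simp add: mult_ac flip: power_mult)

lemma P2_minus_1: "(P - 1) * (P + 1) = P ^ 2 - 1"
  by (simp add: power2_eq_square algebra_simps)

lemma Q_minus_1: "(P ^ 2 - 1) * l = Q - 1"
  unfolding Q_eq by (rule sum_geometric_nat)

text \<open>Identifies \<open>(P - 1) * l\<close> as the exponent \<open>m\<close> belonging to
  \<open>d = P + 1\<close>.\<close>

lemma Q_minus_1': "((P - 1) * l) * (P + 1) = Q - 1"
proof -
  have "((P - 1) * l) * (P + 1) = ((P - 1) * (P + 1)) * l"
    by (simp only: mult_ac)
  also have "\<dots> = Q - 1"
    by (simp only: P2_minus_1 Q_minus_1)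
  finally show ?thesis .
qed

lemma Q_gt_1: "Q > 1"
  using p_gt_2 r_pos e_pos by (intro one_less_power) auto

lemma even_l: "even l \<longleftrightarrow> even e"
  using odd_P by (intro even_sum_powers) simp

lemma Q_dvd: "Q - 1 dvd CARD('a) - 1"
  unfolding card_UNIV by (rule power_minus_1_dvd[OF dvd_N])

lemma card_K: "card K = Q"
  using r_pos e_pos dvd_N by (intro card_subfld) auto

lemma in_K_iff: "x ^ (Q - 1) = 1 \<longleftrightarrow> x \<in> K - {0}"
  using r_pos e_pos by (intro power_frob_subfld) auto

lemmas K_intros = subfld_add subfld_mult subfld_power subfld_minus subfld_diff subfld_divide

text \<open>A \<open>P\<close>-th root is the complementary Frobenius power, because
  \<open>2 * (r * e)\<close> Frobenius steps fix \<open>y\<close>.\<close>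

lemma K_frob_surj:
  assumes "y \<in> K"
  shows "(y ^ p ^ (2 * (r * e) - r)) ^ P = y"
proof -
  have "r \<le> 2 * (r * e)"
    using e_pos by (cases e) auto
  with assms show ?thesis
    by (simp add: subfld_def flip: power_mult power_add)
qed

lemma power_Q_minus_1: "(x::'a) ^ (Q - 1) = (x ^ (P ^ 2 - 1)) ^ l"
  unfolding Q_minus_1[symmetric] by (rule power_mult)

text \<open>The radical of the quadratic form \<open>x \<mapsto> tr (b x ^ (P + 1))\<close>.\<close>
definition W :: "'a \<Rightarrow> 'a set" where
  "W b = {w \<in> K. b ^ P * w ^ (P ^ 2) + b * w = 0}"

text \<open>The argument is the polar form of \<open>b * x ^ (P + 1)\<close>. Raising its first term
  to the power \<open>P\<close> leaves the character unchanged and turns the argument into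
  \<open>y ^ P * c\<close>, where \<open>c = 0\<close> defines \<open>W b\<close>; orthogonality
  then applies.\<close>

lemma polar_sum:
  assumes b: "b \<in> K" and w: "w \<in> K"
  shows "(\<Sum>y\<in>K. \<chi> (b * (y * w ^ P + w * y ^ P))) = (if w \<in> W b then of_nat Q else 0)"
proof -
  define c where "c = b ^ P * w ^ (P ^ 2) + b * w"
  have c: "c \<in> K"
    unfolding c_def using b w by (intro K_intros)
  have eq: "\<chi> (b * (y * w ^ P + w * y ^ P)) = \<chi> (y ^ P * c)" if y: "y \<in> K" for y
  proof -
    have "\<chi> (b * (y * w ^ P + w * y ^ P)) = \<chi> (b * y * w ^ P) * \<chi> (b * w * y ^ P)"
      using b w y by (subst add_char_add[symmetric]) (auto intro!: K_intros simp: algebra_simps)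
    also have "\<chi> (b * y * w ^ P) = \<chi> ((b * y * w ^ P) ^ P)"
      using b w y by (intro add_char_frob[symmetric] K_intros)
    also have "\<dots> * \<chi> (b * w * y ^ P) = \<chi> ((b * y * w ^ P) ^ P + b * w * y ^ P)"
      using b w y by (intro add_char_add[symmetric] K_intros)
    also have "(b * y * w ^ P) ^ P + b * w * y ^ P = y ^ P * c"
      by (simp add: c_def power_mult_distrib power2_eq_square algebra_simps flip: power_mult)
    finally show ?thesis .
  qed
  have iff: "(\<forall>y\<in>K. \<chi> (y ^ P * c) = 1) \<longleftrightarrow> c = 0"
  proof
    assume *: "\<forall>y\<in>K. \<chi> (y ^ P * c) = 1"
    show "c = 0"
    proof (rule ccontr)
      assume "c \<noteq> 0"
      obtain z where z: "z \<in> K" "\<chi> z \<noteq> 1"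
        using add_char_nontrivial[OF _ dvd_N] r_pos e_pos by auto
      \<comment> \<open>Chosen so that \<open>y ^ P * c\<close> is an element \<open>z\<close> on
        which the character is nontrivial.\<close>
      define y where "y = (z / c) ^ p ^ (2 * (r * e) - r)"
      have "y \<in> K"
        unfolding y_def using z c by (intro K_intros)
      moreover have "y ^ P * c = z"
        using K_frob_surj[of "z / c"] z c \<open>c \<noteq> 0\<close> by (simp add: y_def subfld_divide)
      ultimately show False
        using * z by auto
    qed
  qed auto
  have "(\<Sum>y\<in>K. \<chi> (b * (y * w ^ P + w * y ^ P))) = (\<Sum>y\<in>K. \<chi> (y ^ P * c))"
    by (intro sum.cong refl eq)
  also have "\<dots> = (if \<forall>y\<in>K. \<chi> (y ^ P * c) = 1 then of_nat (card K) else 0)"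
  proof (rule sum_additive_char)
    fix x y assume xy: "x \<in> K" "y \<in> K"
    show "\<chi> ((x + y) ^ P * c) = \<chi> (x ^ P * c) * \<chi> (y ^ P * c)"
      using xy c by (subst add_char_add[symmetric]) (auto intro!: K_intros simp: frob_add algebra_simps)
  qed (auto intro: subfld_add)
  finally show ?thesis
    unfolding iff card_K using w by (simp add: W_def c_def)
qed

text \<open>On the radical \<open>z = b w ^ (P + 1)\<close> satisfies \<open>z ^ P = - z\<close>, so \<open>\<chi> z\<close> is its own inverse;
  being also a \<open>p\<close>-th root of unity with \<open>p\<close> odd, it is \<open>1\<close>.\<close>
lemma char_W:
  assumes b: "b \<in> K" and w: "w \<in> W b"
  shows "\<chi> (b * w ^ (P + 1)) = 1"
proof -
  define z where "z = b * w ^ (P + 1)"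
  have z: "z \<in> K"
    unfolding z_def using b w by (auto intro!: K_intros simp: W_def)
  have "z ^ P + z = w ^ P * (b ^ P * w ^ (P ^ 2) + b * w)"
    by (simp add: z_def power_mult_distrib power2_eq_square power_add algebra_simps flip: power_mult)
  also have "\<dots> = 0"
    using w by (simp add: W_def)
  finally have "\<chi> z * \<chi> z = 1"
    using add_char_frob[OF z, of r] add_char_add[OF subfld_power[OF z] z, of P] by simp
  moreover have "\<chi> z ^ p = 1"
    by (rule add_char_power_p[OF z])
  moreover obtain i where "p = 2 * i + 1"
    using odd_p by (auto elim: oddE)
  ultimately have "\<chi> z = 1"
    by (simp add: power_add power_mult power2_eq_square)
  then show ?thesis
    by (simp add: z_def)
qed

text \<open>Substituting \<open>x = w + y\<close> in the double sum separates the value at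
  \<open>w\<close> from the polar form. Summing over \<open>y\<close> leaves only \<open>w\<close>
  in the radical, where the remaining character value is 1.\<close>

lemma norm_weil:
  assumes b: "b \<in> K"
  shows "weil (P + 1) b * cnj (weil (P + 1) b) = of_nat (Q * card (W b))"
proof -
  have "weil (P + 1) b * cnj (weil (P + 1) b)
      = (\<Sum>y\<in>K. \<Sum>x\<in>K. \<chi> (b * x ^ (P + 1)) * cnj (\<chi> (b * y ^ (P + 1))))"
    unfolding weil_def cnj_sum sum_product by (rule sum.swap)
  also have "\<dots> = (\<Sum>y\<in>K. \<Sum>w\<in>K. \<chi> (b * w ^ (P + 1)) * \<chi> (b * (y * w ^ P + w * y ^ P)))"
  proof (rule sum.cong[OF refl])
    fix y assume y: "y \<in> K"
    have "(\<Sum>x\<in>K. \<chi> (b * x ^ (P + 1)) * cnj (\<chi> (b * y ^ (P + 1))))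
        = (\<Sum>x\<in>K. \<chi> (b * x ^ (P + 1) - b * y ^ (P + 1)))"
    proof (rule sum.cong[OF refl])
      fix x assume x: "x \<in> K"
      have bx: "b * x ^ (P + 1) \<in> K" and byy: "b * y ^ (P + 1) \<in> K"
        using b x y by (intro K_intros; simp)+
      show "\<chi> (b * x ^ (P + 1)) * cnj (\<chi> (b * y ^ (P + 1))) = \<chi> (b * x ^ (P + 1) - b * y ^ (P + 1))"
        using add_char_add[OF bx subfld_minus[OF byy]] add_char_minus[OF byy] by simp
    qed
    also have "\<dots> = (\<Sum>w\<in>K. \<chi> (b * (w + y) ^ (P + 1) - b * y ^ (P + 1)))"
      by (rule sum.reindex_bij_witness[of _ "\<lambda>w. w + y" "\<lambda>x. x - y"])
         (use y in \<open>auto intro: subfld_add subfld_diff\<close>)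
    also have "\<dots> = (\<Sum>w\<in>K. \<chi> (b * w ^ (P + 1)) * \<chi> (b * (y * w ^ P + w * y ^ P)))"
    proof (rule sum.cong[OF refl])
      fix w assume w: "w \<in> K"
      have "b * (w + y) ^ (P + 1) - b * y ^ (P + 1) = b * w ^ (P + 1) + b * (y * w ^ P + w * y ^ P)"
        by (simp add: frob_add power_add algebra_simps)
      moreover have "\<chi> (b * w ^ (P + 1) + b * (y * w ^ P + w * y ^ P))
          = \<chi> (b * w ^ (P + 1)) * \<chi> (b * (y * w ^ P + w * y ^ P))"
        using b w y by (intro add_char_add K_intros)
      ultimately show "\<chi> (b * (w + y) ^ (P + 1) - b * y ^ (P + 1)) = \<chi> (b * w ^ (P + 1)) * \<chi> (b * (y * w ^ P + w * y ^ P))"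
        by simp
    qed
    finally show "(\<Sum>x\<in>K. \<chi> (b * x ^ (P + 1)) * cnj (\<chi> (b * y ^ (P + 1))))
        = (\<Sum>w\<in>K. \<chi> (b * w ^ (P + 1)) * \<chi> (b * (y * w ^ P + w * y ^ P)))" .
  qed
  also have "\<dots> = (\<Sum>w\<in>K. \<chi> (b * w ^ (P + 1)) * (\<Sum>y\<in>K. \<chi> (b * (y * w ^ P + w * y ^ P))))"
    by (subst sum.swap) (simp only: sum_distrib_left)
  also have "\<dots> = (\<Sum>w\<in>K. if w \<in> W b then of_nat Q else 0)"
  proof (rule sum.cong[OF refl])
    fix w assume "w \<in> K"
    then show "\<chi> (b * w ^ (P + 1)) * (\<Sum>y\<in>K. \<chi> (b * (y * w ^ P + w * y ^ P))) = (if w \<in> W b then of_nat Q else 0)"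
      by (cases "w \<in> W b") (simp_all only: polar_sum[OF b] char_W[OF b] if_True if_False mult_1_left mult_zero_right)
  qed
  also have "\<dots> = of_nat (Q * card (W b))"
    by (subst sum.inter_restrict[symmetric]) (auto simp: W_def Int_def mult.commute)
  finally show ?thesis .
qed

text \<open>Nonzero radical elements are the solutions in \<open>K\<close> of
  \<open>w ^ (P ^ 2 - 1) = v\<close>. If \<open>v ^ l = 1\<close>, all \<open>P ^ 2 - 1\<close>
  solutions lie in \<open>K\<close>; otherwise none does. The equal parity of \<open>l\<close> and
  \<open>e\<close> turns this condition into the one on \<open>b\<close>.\<close>

lemma card_W:
  assumes b: "b \<in> K" "b \<noteq> 0"
  shows "card (W b) = (if b ^ ((P - 1) * l) = (-1) ^ e then P ^ 2 else 1)"
proof -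
  define v where "v = - (b / b ^ P)"
  have P2: "P ^ 2 > 1"
    using P_gt_2 one_less_power[of P 2] by linarith
  have *: "w \<in> W b \<longleftrightarrow> w \<in> K \<and> w ^ (P ^ 2 - 1) = v" if "w \<noteq> 0" for w
  proof -
    have "w ^ (P ^ 2) = w * w ^ (P ^ 2 - 1)"
      using P2 by (metis One_nat_def Suc_pred less_imp_Suc_add power_Suc zero_less_Suc)
    then have "b ^ P * w ^ (P ^ 2) + b * w = w * b ^ P * (w ^ (P ^ 2 - 1) - v)"
      using b by (simp add: v_def algebra_simps)
    with that b show ?thesis
      by (simp add: W_def)
  qed
  have "b ^ P = b * b ^ (P - 1)"
    using P_gt_2 by (metis less_trans power_eq_if zero_less_numeral less_numeral_extra(3))
  then have "v = (- 1) / b ^ (P - 1)"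
    using b by (simp add: v_def)
  then have "v ^ l = (- 1) ^ l / b ^ ((P - 1) * l)"
    by (simp only: power_divide power_mult)
  also have "(- 1 :: 'a) ^ l = (- 1) ^ e"
    by (simp only: minus_one_power_iff even_l)
  finally have vl: "v ^ l = (-1) ^ e / b ^ ((P - 1) * l)" .
  have in_K: "w \<in> K - {0} \<longleftrightarrow> v ^ l = 1" if "w ^ (P ^ 2 - 1) = v" for w
    using power_Q_minus_1[of w] that in_K_iff[of w] by simp
  show ?thesis
  proof (cases "v ^ l = 1")
    case True
    have "w ^ (P ^ 2 - 1) \<noteq> v" if "w = 0" for w
      using in_K[of w] True that by auto
    with True in_K * have "W b = insert 0 {w. w ^ (P ^ 2 - 1) = v}"
      using p_gt_2 by (auto simp: W_def)
    moreover have "card {w. w ^ (P ^ 2 - 1) = v} = P ^ 2 - 1"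
      by (rule card_power_eq[OF _ True]) (use Q_dvd Q_minus_1 in simp)
    moreover have "0 \<notin> {w. w ^ (P ^ 2 - 1) = v}"
      using in_K True by auto
    ultimately have "card (W b) = P ^ 2"
      using P2 by simp
    with True b show ?thesis
      by (simp add: vl)
  next
    case False
    with in_K * have "W b = {0}"
      using p_gt_2 by (auto simp: W_def)
    with False b show ?thesis
      by (simp add: vl)
  qed
qed

section \<open>Integrality, sign and value of the Weil sums\<close>

lemma weil_mult_power:
  assumes y: "y \<in> K" "y \<noteq> 0"
  shows "weil d (y ^ d * b) = weil d b"
  unfolding weil_def
  by (rule sum.reindex_bij_witness[of _ "\<lambda>x. x / y" "\<lambda>x. y * x"])
     (use y in \<open>auto intro: subfld_mult subfld_divide simp: power_mult_distrib mult_ac\<close>)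

lemma P2_minus_1_dvd: "P ^ 2 - 1 dvd CARD('a) - 1"
  using Q_dvd Q_minus_1 by (metis dvd_trans dvd_triv_left)

text \<open>Since \<open>c ^ (P - 1) = 1\<close> and \<open>(P + 1) * (P - 1)\<close> divides
  \<open>Q - 1\<close>, \<open>c\<close> has a \<open>(P + 1)\<close>-th root, and this root lies in
  \<open>K\<close>; it can be absorbed into the summation variable.\<close>

lemma weil_scale:
  assumes c: "c \<in> subfld p r" "c \<noteq> 0"
  shows "weil (P + 1) (c * b) = weil (P + 1) b"
proof -
  have c1: "c ^ (P - 1) = 1"
    using c power_frob_subfld[OF r_pos] by auto
  have "card {y. y ^ (P + 1) = c} = P + 1"
    by (rule card_power_eq[OF _ c1]) (use P2_minus_1_dvd P2_minus_1 in \<open>simp add: mult.commute\<close>)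
  then have "{y. y ^ (P + 1) = c} \<noteq> {}"
    by (intro notI) simp
  then obtain y where y: "y ^ (P + 1) = c"
    by blast
  have "y ^ (Q - 1) = ((y ^ (P + 1)) ^ (P - 1)) ^ l"
    unfolding power_Q_minus_1 P2_minus_1[symmetric] by (simp only: mult.commute[of "P - 1"] power_mult)
  also have "\<dots> = 1"
    by (simp only: y c1 power_one)
  finally have "y \<in> K - {0}"
    using in_K_iff by blast
  with weil_mult_power[of y "P + 1" b] y show ?thesis
    by simp
qed

text \<open>Summing over the multiples \<open>c b\<close> with \<open>c\<close> in the subfield of order \<open>P\<close> gives
  \<open>Q + (P - 1) S b = P \<bar>Z\<bar>\<close>, and the nonzero part of \<open>Z\<close> is stable under the free action
  of the \<open>(P\<^sup>2 - 1)\<close>-th roots of unity.\<close>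
lemma weil_cong_1:
  assumes b: "b \<in> K"
  obtains z :: int where "weil (P + 1) b = of_int z" "[z = 1] (mod int (P + 1))"
proof -
  let ?L = "subfld p r :: 'a set"
  define Z where "Z = {x \<in> K. \<forall>c\<in>?L. \<chi> (c * (b * x ^ (P + 1))) = 1}"
  have L_K: "x \<in> K" if "x \<in> ?L" for x
    using that by (rule subfld_mono[rotated]) simp
  have "r dvd N"
    using dvd_N by (meson dvd_mult dvd_mult_left dvd_trans dvd_triv_left dvd_triv_right)
  then have card_L: "card ?L = P"
    using r_pos by (intro card_subfld)
  have P2: "P ^ 2 > 1"
    using P_gt_2 one_less_power[of P 2] by linarith
  have "(P ^ 2 - 1) dvd card (Z - {0})"
  proof (rule card_dvd_of_root_of_unity_invariant)
    show "card {h::'a. h ^ (P ^ 2 - 1) = 1} = P ^ 2 - 1"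
      by (rule card_power_eq[where l = 1]) (use P2_minus_1_dvd in auto)
    fix h x :: 'a assume h: "h ^ (P ^ 2 - 1) = 1" and x: "x \<in> Z - {0}"
    have "h ^ (Q - 1) = 1"
      by (simp only: power_Q_minus_1 h power_one)
    then have hK: "h \<in> K - {0}"
      using in_K_iff by blast
    \<comment> \<open>The factor \<open>h ^ (P + 1)\<close> lies in the subfield of order
      \<open>P\<close>, so it can be absorbed into \<open>c\<close>.\<close>
    have "(h ^ (P + 1)) ^ (P - 1) = h ^ ((P + 1) * (P - 1))"
      by (rule power_mult[symmetric])
    also have "\<dots> = 1"
      by (simp only: mult.commute[of "P + 1"] P2_minus_1 h)
    finally have "(h ^ (P + 1)) ^ (P - 1) = 1" .
    then have hL: "h ^ (P + 1) \<in> ?L"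
      using power_frob_subfld[OF r_pos] by blast
    have "\<chi> (c * (b * (h * x) ^ (P + 1))) = 1" if "c \<in> ?L" for c
    proof -
      have "\<chi> ((c * h ^ (P + 1)) * (b * x ^ (P + 1))) = 1"
        using x subfld_mult[OF that hL] unfolding Z_def by blast
      then show ?thesis
        by (simp only: power_mult_distrib mult_ac)
    qed
    with x hK show "h * x \<in> Z - {0}"
      by (auto simp: Z_def subfld_mult)
  qed (use P2 in auto)
  then obtain M where M: "card (Z - {0}) = (P ^ 2 - 1) * M"
    by (auto elim: dvdE)
  have "0 \<in> Z"
    using p_gt_2 by (simp add: Z_def)
  then have cZ: "card Z = 1 + (P ^ 2 - 1) * M"
    using M card_Suc_Diff1[of Z 0] by simp
  have "(\<Sum>c\<in>?L. weil (P + 1) (c * b)) = (\<Sum>x\<in>K. \<Sum>c\<in>?L. \<chi> (c * (b * x ^ (P + 1))))"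
    unfolding weil_def by (subst sum.swap) (simp only: mult.assoc)
  also have "\<dots> = (\<Sum>x\<in>K. if x \<in> Z then of_nat P else 0)"
  proof (rule sum.cong[OF refl])
    fix x assume x: "x \<in> K"
    have "(\<Sum>c\<in>?L. \<chi> (c * (b * x ^ (P + 1))))
       = (if \<forall>c\<in>?L. \<chi> (c * (b * x ^ (P + 1))) = 1 then of_nat (card ?L) else 0)"
    proof (rule sum_additive_char)
      fix c c' :: 'a assume c: "c \<in> ?L" "c' \<in> ?L"
      show "\<chi> ((c + c') * (b * x ^ (P + 1))) = \<chi> (c * (b * x ^ (P + 1))) * \<chi> (c' * (b * x ^ (P + 1)))"
        unfolding distrib_right using c b x L_K by (intro add_char_add K_intros) auto
    qed (auto intro: subfld_add)
    then show "(\<Sum>c\<in>?L. \<chi> (c * (b * x ^ (P + 1)))) = (if x \<in> Z then of_nat P else 0)"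
      using x by (simp add: Z_def card_L)
  qed
  also have "\<dots> = of_nat (P * card Z)"
    by (subst sum.inter_restrict[symmetric]) (auto simp: Z_def Int_def mult.commute)
  finally have 1: "(\<Sum>c\<in>?L. weil (P + 1) (c * b)) = of_nat (P * card Z)" .
  have "(\<Sum>c\<in>?L. weil (P + 1) (c * b)) = weil (P + 1) 0 + (\<Sum>c\<in>?L - {0}. weil (P + 1) (c * b))"
    by (subst sum.remove[of _ 0]) auto
  also have "weil (P + 1) 0 = of_nat Q"
    by (simp add: weil_def card_K)
  also have "(\<Sum>c\<in>?L - {0}. weil (P + 1) (c * b)) = (\<Sum>c\<in>?L - {0}. weil (P + 1) b)"
    by (intro sum.cong refl weil_scale) auto
  also have "\<dots> = of_nat (P - 1) * weil (P + 1) b"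
    using card_L by simp
  finally have 2: "of_nat Q + of_nat (P - 1) * weil (P + 1) b = of_nat (P * card Z)"
    using 1 by simp
  \<comment> \<open>Solves \<open>Q + (P - 1) * z = P * card Z\<close> after inserting
    \<open>card Z = 1 + (P ^ 2 - 1) * M\<close> and \<open>Q = (P ^ 2 - 1) * l + 1\<close>.\<close>
  define z where "z = 1 + int (P + 1) * (int P * int M - int l)"
  have P1: "int (P - 1) = int P - 1"
    using P_gt_2 by simp
  have "Q = (P - 1) * (P + 1) * l + 1"
    using Q_gt_1 by (simp only: P2_minus_1 Q_minus_1)
  then have "int Q = (int P - 1) * (int P + 1) * int l + 1"
    using P1 by (metis of_nat_1 of_nat_add of_nat_mult)
  moreover have "int (P * card Z) = int P * (1 + (int P - 1) * (int P + 1) * int M)"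
    using cZ P1 by (metis P2_minus_1 of_nat_1 of_nat_add of_nat_mult)
  ultimately have "int (P * card Z) - int Q = int (P - 1) * z"
    unfolding P1 z_def by (simp add: algebra_simps)
  then have "of_nat (P - 1) * weil (P + 1) b = of_nat (P - 1) * (of_int z :: complex)"
    using 2 by (metis add_diff_cancel_left' of_int_diff of_int_mult of_int_of_nat_eq)
  then have "weil (P + 1) b = of_int z"
    using P_gt_2 by (subst (asm) mult_left_cancel) (simp only: of_nat_eq_0_iff; linarith)+
  moreover have "[z = 1] (mod int (P + 1))"
    by (simp add: z_def cong_iff_dvd_diff)
  ultimately show ?thesis
    using that by blast
qed

lemma P_power_cong: "[int P ^ i = (-1) ^ i] (mod int (P + 1))"
  by (intro cong_pow) (simp add: cong_iff_dvd_diff add.commute)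

text \<open>The norm leaves two integers of opposite sign. One of them is congruent to 1 and the
  other to -1 modulo \<open>P + 1\<close>, and these classes differ because
  \<open>P + 1 > 2\<close>.\<close>

lemma weil_Suc:
  assumes b: "b \<in> K" "b \<noteq> 0"
  shows "weil (P + 1) b
    = of_int ((-1) ^ e * int P ^ e * (if b ^ ((P - 1) * l) = (-1) ^ e then 1 - int (P + 1) else 1))"
proof -
  obtain z where z: "weil (P + 1) b = of_int z" "[z = 1] (mod int (P + 1))"
    using weil_cong_1[OF b(1)] .
  \<comment> \<open>Records a nontrivial radical, which contributes one more factor
    \<open>- P\<close>, that is \<open>1 - int (P + 1)\<close>.\<close>
  define f where "f = (if b ^ ((P - 1) * l) = (-1) ^ e then 1 else 0 :: nat)"
  have "Q * card (W b) = (P ^ (e + f)) ^ 2"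
    unfolding card_W[OF b] Q_eq f_def by (simp add: power2_eq_square power_mult_distrib mult_ac)
  then have "(of_int (z * z) :: complex) = of_int ((int P ^ (e + f)) ^ 2)"
    using norm_weil[OF b(1)] z(1) by (simp add: power2_eq_square)
  then have "z ^ 2 = (int P ^ (e + f)) ^ 2"
    by (simp only: of_int_eq_iff power2_eq_square)
  then have "z = int P ^ (e + f) \<or> z = - (int P ^ (e + f))"
    by (simp add: power2_eq_iff)
  then have z_cases: "z = (-1) ^ (e + f) * int P ^ (e + f) \<or> z = - ((-1) ^ (e + f) * int P ^ (e + f))"
    by (cases "even (e + f)") auto
  have "[(-1) ^ (e + f) * int P ^ (e + f) = (-1) ^ (e + f) * (-1) ^ (e + f)] (mod int (P + 1))"
    by (intro cong_mult cong_refl P_power_cong)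
  then have 1: "[(-1) ^ (e + f) * int P ^ (e + f) = 1] (mod int (P + 1))"
    by (simp flip: power_add mult_2)
  have "z \<noteq> - ((-1) ^ (e + f) * int P ^ (e + f))"
  proof
    assume "z = - ((-1) ^ (e + f) * int P ^ (e + f))"
    then have "[z = - 1] (mod int (P + 1))"
      using 1 by (simp only: cong_minus_minus_iff)
    with z(2) have "[1 = - 1 :: int] (mod int (P + 1))"
      by (meson cong_sym cong_trans)
    then have "int (P + 1) dvd int 2"
      by (simp add: cong_iff_dvd_diff)
    then have "P + 1 dvd 2"
      by (simp only: int_dvd_int_iff)
    then show False
      using P_gt_2 by (auto dest: dvd_imp_le)
  qed
  with z_cases have "z = (-1) ^ (e + f) * int P ^ (e + f)"
    by blast
  with z(1) show ?thesis
    by (simp add: f_def)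
qed

text \<open>Evaluates the sum of \<open>weil (P + 1) (y ^ d * b)\<close> over nonzero
  \<open>y\<close> twice. Since \<open>d * u = P + 1\<close>, substituting \<open>y * x ^ u\<close>
  gives \<open>(Q - 1) * weil d b\<close>; \<open>weil_Suc\<close> gives the value by counting the
  exceptional \<open>y\<close>.\<close>

lemma weil_dvd:
  assumes b: "b \<in> K" "b \<noteq> 0" and du: "d * u = P + 1"
  shows "weil d b = of_int ((-1) ^ e * int P ^ e *
           (if b ^ (u * ((P - 1) * l)) = ((-1) ^ e) ^ u then 1 - int d else 1))"
proof -
  define m where "m = (P - 1) * l"
  \<comment> \<open>The \<open>y\<close> for which \<open>y ^ d * b\<close> falls into the
    exceptional case of \<open>weil_Suc\<close>.\<close>
  define Y where "Y = {y \<in> K - {0}. (b * y ^ d) ^ m = (-1) ^ e}"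
  \<comment> \<open>For nonzero \<open>y\<close> in \<open>K\<close>, membership in \<open>Y\<close>
    means \<open>y ^ (d * m) = w\<close>. Such roots lie in \<open>K\<close> exactly when
    \<open>w ^ u = 1\<close>, so \<open>Y\<close> contains all of them or is empty.\<close>
  define w :: 'a where "w = (-1) ^ e / b ^ m"
  let ?C = "b ^ (u * m) = ((-1) ^ e) ^ u"
  have u: "u > 0" and d: "d > 0"
    using du by (auto intro: gr0I)
  have Qm: "Q - 1 = d * m * u"
    unfolding m_def Q_minus_1'[symmetric] du[symmetric] by (simp only: mult_ac)
  have w_iff: "w ^ u = 1 \<longleftrightarrow> ?C"
    using b by (auto simp: w_def power_divide mult.commute simp flip: power_mult)
  have Y_iff: "y \<in> Y \<longleftrightarrow> y \<in> K - {0} \<and> y ^ (d * m) = w" for y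
    using b by (auto simp: Y_def w_def power_mult_distrib field_simps simp flip: power_mult)
  have in_K: "y \<in> K - {0} \<longleftrightarrow> w ^ u = 1" if "y ^ (d * m) = w" for y
    using in_K_iff[of y] that unfolding Qm power_mult[of y "d * m"] by simp
  have if_eq: "x * (y - y * (if c then z else 0)) = y * (x * (if c then 1 - z else 1))" for x y z :: int and c
    by (simp add: algebra_simps)
  have card_Y: "card Y = (if ?C then d * m else 0)"
  proof (cases ?C)
    case True
    then have "Y = {y. y ^ (d * m) = w}"
      using Y_iff in_K w_iff by blast
    also have "card \<dots> = d * m"
      by (rule card_power_eq[where l = u]) (use Q_dvd Qm True w_iff in auto)
    finally show ?thesis
      using True by simp
  next
    case False
    then have "Y = {}"
      using Y_iff in_K w_iff by blast
    with False show ?thesis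
      by simp
  qed
  have "(y * x ^ u) ^ d = y ^ d * x ^ (P + 1)" for x y :: 'a
    by (simp only: du[symmetric] power_mult_distrib mult.commute[of d] power_mult)
  then have "(\<Sum>y\<in>K - {0}. weil (P + 1) (y ^ d * b)) = (\<Sum>x\<in>K. \<Sum>y\<in>K - {0}. \<chi> (b * (y * x ^ u) ^ d))"
    unfolding weil_def by (subst sum.swap) (simp only: mult_ac)
  also have "\<dots> = (\<Sum>x\<in>K. if x = 0 then of_nat (Q - 1) else weil d b - 1)"
  proof (rule sum.cong[OF refl])
    fix x assume x: "x \<in> K"
    show "(\<Sum>y\<in>K - {0}. \<chi> (b * (y * x ^ u) ^ d)) = (if x = 0 then of_nat (Q - 1) else weil d b - 1)"
    proof (cases "x = 0")
      case True
      then show ?thesis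
        using u d card_K by (simp add: power_0_left)
    next
      case False
      have "(\<Sum>y\<in>K - {0}. \<chi> (b * (y * x ^ u) ^ d)) = (\<Sum>y\<in>K - {0}. \<chi> (b * y ^ d))"
        by (rule sum.reindex_bij_witness[of _ "\<lambda>y. y / x ^ u" "\<lambda>y. y * x ^ u"])
           (use False x in \<open>auto intro!: K_intros\<close>)
      also have "\<dots> = weil d b - 1"
        unfolding weil_def using d by (subst (2) sum.remove[of _ 0]) (auto simp: power_0_left)
      finally show ?thesis
        using False by simp
    qed
  qed
  also have "\<dots> = of_nat (Q - 1) + (\<Sum>x\<in>K - {0}. weil d b - 1)"
    by (subst sum.remove[of _ 0]) (auto intro: sum.cong)
  also have "\<dots> = of_nat (Q - 1) * weil d b"
    using card_K by (simp add: algebra_simps)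
  finally have 1: "(\<Sum>y\<in>K - {0}. weil (P + 1) (y ^ d * b)) = of_nat (Q - 1) * weil d b" .
  let ?E = "(-1) ^ e * int P ^ e"
  have "(\<Sum>y\<in>K - {0}. weil (P + 1) (y ^ d * b))
      = of_int (\<Sum>y\<in>K - {0}. ?E - (if y \<in> Y then ?E * int (P + 1) else 0))"
    unfolding of_int_sum
  proof (rule sum.cong[OF refl])
    fix y assume y: "y \<in> K - {0}"
    then have yb: "y ^ d * b \<in> K" "y ^ d * b \<noteq> 0"
      using b by (auto intro: K_intros)
    have "y \<in> Y \<longleftrightarrow> (y ^ d * b) ^ ((P - 1) * l) = (-1) ^ e"
      using y by (simp only: Y_def m_def mult.commute[of b] mem_Collect_eq simp_thms)
    with weil_Suc[OF yb] have "weil (P + 1) (y ^ d * b) = of_int (?E * (if y \<in> Y then 1 - int (P + 1) else 1))"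
      by (simp only:)
    also have "?E * (if y \<in> Y then 1 - int (P + 1) else 1) = ?E - (if y \<in> Y then ?E * int (P + 1) else 0)"
      by (simp add: algebra_simps)
    finally show "weil (P + 1) (y ^ d * b) = of_int (?E - (if y \<in> Y then ?E * int (P + 1) else 0))" .
  qed
  also have "(\<Sum>y\<in>K - {0}. ?E - (if y \<in> Y then ?E * int (P + 1) else 0))
      = ?E * (int (Q - 1) - int (P + 1) * int (card Y))"
  proof -
    have "(\<Sum>y\<in>K - {0}. if y \<in> Y then ?E * int (P + 1) else 0) = ?E * int (P + 1) * int (card Y)"
    proof -
      have "(K - {0}) \<inter> Y = Y"
        by (auto simp: Y_def)
      then show ?thesis
        using sum.inter_restrict[of "K - {0}" "\<lambda>_. ?E * int (P + 1)" Y] by (simp add: mult.commute)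
    qed
    moreover have "card (K - {0}) = Q - 1"
      using card_K by simp
    ultimately show ?thesis
      by (simp add: sum_subtractf right_diff_distrib)
  qed
  \<comment> \<open>If \<open>Y\<close> is nonempty, \<open>(P + 1) * (d * m) = (Q - 1) * d\<close>,
    by \<open>P + 1 = d * u\<close> and \<open>Q - 1 = d * m * u\<close>.\<close>
  also have "int (P + 1) * int (card Y) = int (Q - 1) * (if ?C then int d else 0)"
    unfolding card_Y Qm du[symmetric] by simp
  also have "?E * (int (Q - 1) - int (Q - 1) * (if ?C then int d else 0))
      = int (Q - 1) * (?E * (if ?C then 1 - int d else 1))"
    by (rule if_eq)
  finally have "of_nat (Q - 1) * weil d b = of_nat (Q - 1) * of_int (?E * (if ?C then 1 - int d else 1))"
    unfolding 1 by (simp only: of_int_mult of_int_of_nat_eq)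
  then have "weil d b = of_int (?E * (if ?C then 1 - int d else 1))"
    using Q_gt_1 by (subst (asm) mult_left_cancel) (simp only: of_nat_eq_0_iff; linarith)+
  then show ?thesis
    by (simp only: m_def)
qed

end

subsection \<open>Counting solutions\<close>

context odd_finite_field begin

text \<open>Transitivity of the trace: every Frobenius exponent below \<open>2 * n\<close> is
  uniquely \<open>j + i * (2 * t)\<close> with \<open>j < 2 * t\<close>.\<close>

lemma abs_trace_trace:
  assumes "t dvd n"
  shows "abs_trace p (2 * n) (z::'a) = abs_trace p (2 * t) (trace p n t z)"
proof -
  have "abs_trace p (2 * t) (trace p n t z) = (\<Sum>j<2 * t. \<Sum>i<n div t. z ^ p ^ (j + i * (2 * t)))"
    unfolding abs_trace_def trace_def frob_sum
    by (simp add: power_add mult_ac flip: power_mult)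
  also have "\<dots> = (\<Sum>i<n div t. \<Sum>j<2 * t. z ^ p ^ (j + i * (2 * t)))"
    by (rule sum.swap)
  also have "\<dots> = (\<Sum>i<n div t. \<Sum>j\<in>{i * (2 * t)..<i * (2 * t) + 2 * t}. z ^ p ^ j)"
  proof (rule sum.cong[OF refl])
    fix i
    show "(\<Sum>j<2 * t. z ^ p ^ (j + i * (2 * t))) = (\<Sum>j\<in>{i * (2 * t)..<i * (2 * t) + 2 * t}. z ^ p ^ j)"
      using sum.shift_bounds_nat_ivl[of "\<lambda>j. z ^ p ^ j" 0 "i * (2 * t)" "2 * t"]
      by (simp add: atLeast0LessThan add.commute)
  qed
  also have "\<dots> = (\<Sum>j<n div t * (2 * t). z ^ p ^ j)"
    by (rule sum.nat_group)
  also have "n div t * (2 * t) = 2 * n"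
    using assms by simp
  finally show ?thesis
    by (simp add: abs_trace_def)
qed

text \<open>The Frobenius power for \<open>2 * t\<close> permutes the summands cyclically, the cycle
  closing because \<open>z ^ p ^ N = z\<close>.\<close>

lemma trace_in_subfld:
  assumes "t dvd n" "N = 2 * n"
  shows "trace p n t (z::'a) \<in> subfld p (2 * t)"
proof -
  have "trace p n t z ^ p ^ (2 * t) = (\<Sum>j<n div t. z ^ p ^ (2 * t * Suc j))"
    unfolding trace_def frob_sum by (simp add: power_add mult_ac flip: power_mult)
  also have "\<dots> + z = trace p n t z + z ^ p ^ (2 * t * (n div t))"
    using sum.lessThan_Suc[of "\<lambda>j. z ^ p ^ (2 * t * j)" "n div t"]
      sum.lessThan_Suc_shift[of "\<lambda>j. z ^ p ^ (2 * t * j)" "n div t"]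
    by (simp add: trace_def add.commute del: sum.lessThan_Suc)
  also have "2 * t * (n div t) = N"
    using assms by simp
  also have "z ^ p ^ N = z"
    using subfld_UNIV by (auto simp: subfld_def)
  finally show ?thesis
    by (simp add: subfld_def)
qed

lemma trace_mult_right:
  assumes "x \<in> subfld p (2 * t)"
  shows "trace p n t (z * x :: 'a) = trace p n t z * x"
proof -
  have "x ^ p ^ (2 * t * j) = x" for j
    using subfld_mono[OF _ assms, of "2 * t * j"] by (simp add: subfld_def)
  then show ?thesis
    by (simp add: trace_def power_mult_distrib sum_distrib_right)
qed

text \<open>Transitivity and linearity of the trace reduce the sum to a Weil sum with coefficient
  \<open>T\<close>. For \<open>T = 0\<close> every term is 1; otherwise \<open>weil_dvd\<close>
  applies.\<close>

lemma sum_add_char_eq_Delta: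
  assumes N: "N = 2 * n" and t: "t > 0" "t dvd n" and r: "r dvd t" and d: "d dvd p ^ r + 1"
  shows "(\<Sum>x\<in>subfld p (2 * t). add_char p N (c * (a * x ^ d) :: 'a))
       = of_int (int p ^ t * Delta p n a d t r c)"
proof -
  define T where "T = trace p n t (c * a)"
  have d0: "d > 0"
    using d by (intro gr0I) simp
  have r0: "r > 0"
    using r t by (intro gr0I) simp
  have T: "T \<in> subfld p (2 * t)"
    unfolding T_def by (rule trace_in_subfld[OF t(2) N])
  have "(\<Sum>x\<in>subfld p (2 * t). add_char p N (c * (a * x ^ d) :: 'a))
      = (\<Sum>x\<in>subfld p (2 * t). add_char p (2 * t) (T * x ^ d))"
    unfolding add_char_def N abs_trace_trace[OF t(2)] T_def
    by (intro sum.cong refl) (simp add: subfld_power flip: trace_mult_right mult.assoc)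
  also have "\<dots> = of_int (int p ^ t * Delta p n a d t r c)"
  proof (cases "T = 0")
    case True
    have "card (subfld p (2 * t) :: 'a set) = p ^ (2 * t)"
      using t N by (intro card_subfld) auto
    then have "card (subfld p (2 * t) :: 'a set) = p ^ t * p ^ t"
      by (simp add: mult_2 power_add)
    with True show ?thesis
      by (simp add: Delta_def T_def)
  next
    case False
    define e where "e = t div r"
    have t_eq: "r * e = t"
      using r by (simp add: e_def)
    interpret weil_sum p N ty r e
      by unfold_locales (use t r0 t_eq N in \<open>auto intro: gr0I\<close>)
    define u where "u = (p ^ r + 1) div d"
    have du: "d * u = p ^ r + 1"
      using d by (simp add: u_def)
    \<comment> \<open>Matches the exponent in \<open>weil_dvd\<close> with the \<open>m\<close> in
      \<open>Delta\<close>.\<close>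
    have "Q - 1 = d * (u * ((P - 1) * l))"
      unfolding Q_minus_1'[symmetric] du[symmetric] by (simp only: mult_ac)
    then have m: "(p ^ (2 * t) - 1) div d = u * ((P - 1) * l)"
      using d0 t_eq by simp
    have "(\<Sum>x\<in>subfld p (2 * t). add_char p (2 * t) (T * x ^ d)) = weil d T"
      by (simp add: weil_def t_eq)
    also have "\<dots> = of_int ((-1) ^ e * int P ^ e *
           (if T ^ (u * ((P - 1) * l)) = ((-1) ^ e) ^ u then 1 - int d else 1))"
      using T False by (intro weil_dvd[OF _ _ du]) (simp_all only: t_eq not_False_eq_True)
    also have "int P ^ e = int p ^ t"
      by (simp add: power_mult flip: t_eq)
    also have "(-1) ^ e * int p ^ t * (if T ^ (u * ((P - 1) * l)) = ((-1) ^ e) ^ u then 1 - int d else 1)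
        = int p ^ t * Delta p n a d t r c"
    proof -
      have "Delta p n a d t r c = (if T ^ (u * ((P - 1) * l)) = of_int (((-1) ^ e) ^ u)
          then (-1) ^ e * (1 - int d) else (-1) ^ e)"
        using False unfolding Delta_def Let_def m[symmetric] unfolding T_def u_def e_def by simp
      then show ?thesis
        by (simp only: of_int_power of_int_minus of_int_1) simp
    qed
    finally show ?thesis .
  qed
  finally show ?thesis .
qed

text \<open>Orthogonality in the coefficient \<open>c\<close>, the detector of the equation
  \<open>y = 0\<close>.\<close>

lemma sum_add_char_UNIV:
  "(\<Sum>c\<in>UNIV. add_char p N (c * y :: 'a)) = (if y = 0 then of_nat (p ^ N) else 0)"
proof -
  have all: "x \<in> subfld p N" for x :: 'a
    using subfld_UNIV by simp
  have "(\<forall>c. add_char p N (c * y) = 1) \<longleftrightarrow> y = 0"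
  proof
    assume *: "\<forall>c. add_char p N (c * y) = 1"
    obtain z :: 'a where "add_char p N z \<noteq> 1"
      using add_char_nontrivial[OF N_pos] by auto
    moreover have "z / y * y = z" if "y \<noteq> 0"
      using that by simp
    ultimately show "y = 0"
      using * by metis
  qed simp
  moreover have "(\<Sum>c\<in>UNIV. add_char p N (c * y))
      = (if \<forall>c\<in>UNIV. add_char p N (c * y) = 1 then of_nat CARD('a) else 0)"
    by (rule sum_additive_char) (auto simp: distrib_right add_char_add all)
  ultimately show ?thesis
    by (simp add: card_UNIV)
qed

end

theorem theorem1p2:
  fixes p n s :: nat
    and a :: "nat \<Rightarrow> 'a::{field,finite}"
    and t d r :: "nat \<Rightarrow> nat"
  assumes "prime p" and "odd p" and "n > 0"
    and "CARD('a) = p ^ (2 * n)"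
    and "s \<ge> 1"
    and "\<forall>i<s. t i > 0 \<and> t i dvd n"
    and "\<forall>i<s. d i > 0"
    and "\<forall>i<s. r i dvd t i \<and> d i dvd (p ^ r i + 1)"
  shows "real (card {x :: nat \<Rightarrow> 'a.
                 (\<forall>i<s. x i \<in> subfld p (2 * t i)) \<and> (\<forall>i\<ge>s. x i = 0) \<and>
                 (\<Sum>i<s. a i * x i ^ d i) = 0})
         = real p powi (int (\<Sum>i<s. t i) - 2 * int n) *
           real_of_int (\<Sum>c\<in>(UNIV :: 'a set). \<Prod>i<s. Delta p n (a i) (d i) (t i) (r i) c)"
proof -
  interpret odd_finite_field p "2 * n" "TYPE('a)"
    by unfold_locales (use assms in auto)
  let ?X = "{x :: nat \<Rightarrow> 'a. (\<forall>i<s. x i \<in> subfld p (2 * t i)) \<and> (\<forall>i\<ge>s. x i = 0) \<and>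
                 (\<Sum>i<s. a i * x i ^ d i) = 0}"
  let ?\<psi> = "add_char p (2 * n) :: 'a \<Rightarrow> complex"
  let ?D = "\<Sum>c\<in>(UNIV :: 'a set). \<Prod>i<s. Delta p n (a i) (d i) (t i) (r i) c"
  define F where "F g = (\<Sum>i<s. a i * g i ^ d i)" for g :: "nat \<Rightarrow> 'a"
  define G where "G = (\<Pi>\<^sub>E i\<in>{..<s}. subfld p (2 * t i) :: 'a set)"
  have fin_G: "finite G"
    unfolding G_def by (intro finite_PiE) auto
  have UNIV: "x \<in> subfld p (2 * n)" for x :: 'a
    using subfld_UNIV by simp
  \<comment> \<open>Tuples are padded with 0 from index \<open>s\<close> on in the statement, but
    with \<open>undefined\<close> in \<open>G\<close>, the form needed for
    \<open>prod_sum_PiE\<close>.\<close>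
  have "bij_betw (\<lambda>x. restrict x {..<s}) ?X {g \<in> G. F g = 0}"
    by (rule bij_betw_byWitness[where f' = "\<lambda>g i. if i < s then g i else 0"])
       (auto simp: G_def F_def PiE_def extensional_def fun_eq_iff)
  then have card_X: "card ?X = card {g \<in> G. F g = 0}"
    by (rule bij_betw_same_card)
  have "of_nat (card ?X * p ^ (2 * n)) = (\<Sum>g\<in>G. if F g = 0 then of_nat (p ^ (2 * n)) else 0 :: complex)"
    unfolding card_X using fin_G by (subst sum.inter_filter[symmetric]) auto
  also have "\<dots> = (\<Sum>c\<in>UNIV. \<Sum>g\<in>G. ?\<psi> (c * F g))"
    by (subst sum.swap) (simp only: sum_add_char_UNIV)
  \<comment> \<open>The character turns the sum over \<open>i\<close> into a product, and summing
    over tuples then factors coordinatewise.\<close>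
  also have "\<dots> = (\<Sum>c\<in>UNIV. \<Prod>i<s. \<Sum>y\<in>subfld p (2 * t i). ?\<psi> (c * (a i * y ^ d i)))"
    unfolding F_def G_def
    by (subst prod_sum_PiE) (auto simp: sum_distrib_left add_char_sum UNIV)
  also have "\<dots> = (\<Sum>c\<in>UNIV. \<Prod>i<s. of_int (int p ^ t i * Delta p n (a i) (d i) (t i) (r i) c))"
    using assms by (intro sum.cong prod.cong refl sum_add_char_eq_Delta) auto
  also have "\<dots> = of_int (int p ^ (\<Sum>i<s. t i) * ?D)"
    by (simp add: prod.distrib power_sum sum_distrib_left)
  finally have "(of_int (int (card ?X * p ^ (2 * n))) :: complex) = of_int (int p ^ (\<Sum>i<s. t i) * ?D)"
    by simp
  then have "int (card ?X * p ^ (2 * n)) = int p ^ (\<Sum>i<s. t i) * ?D"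
    by (simp only: of_int_eq_iff)
  then have "real_of_int (int (card ?X * p ^ (2 * n))) = real_of_int (int p ^ (\<Sum>i<s. t i) * ?D)"
    by (simp only:)
  then have eq: "real (card ?X) * real p ^ (2 * n) = real p ^ (\<Sum>i<s. t i) * real_of_int ?D"
    by (simp only: of_int_of_nat_eq of_nat_mult of_nat_power of_int_mult of_int_power)
  have p0: "real p \<noteq> 0"
    using p_gt_2 by simp
  \<comment> \<open>The exponent may be negative, so the count is first obtained multiplied by
    \<open>p ^ (2 * n)\<close> and divided only here.\<close>
  have "real p powi (int (\<Sum>i<s. t i) - 2 * int n) = real p powi int (\<Sum>i<s. t i) / real p powi int (2 * n)"
    using p0 by (subst power_int_diff[symmetric]) auto
  also have "\<dots> = real p ^ (\<Sum>i<s. t i) / real p ^ (2 * n)"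
    by (simp only: power_int_of_nat)
  finally show ?thesis
    using eq p0 by (simp only: times_divide_eq_left) (simp add: field_simps)
qed

end
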